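(* Let $m,n\ge 1$ and let $\omega\in\mathbb{C}$ be a primitive $m$-th root of unity. For any $\pi\in C_m\wr S_n$, $$\text{flag-major}(\pi)=m\cdot\text{major}(\pi)+\sum_{j=0}^{m-1} j\cdot\#\left\{i:\frac{\pi(i)}{|\pi(i)|}=\omega^j\right\},$$ where $\text{major}(\pi)$ is defined with respect to the linear order $$1\cdot\omega^{m-1}<\cdots<n\cdot\omega^{m-1}<\cdots<1\cdot\omega^1<\cdots<n\cdot\omega^1<1\cdot\omega^0<\cdots<n\cdot\omega^0 .$$
   Context: Elements of $C_m\wr S_n$ ($C_m$ cyclic of order $m$) are generalized permutations $\pi=(\pi(1),\dots,\pi(n))$: each $\pi(i)\in\mathbb{C}$, each $\pi(i)/|\pi(i)|$ is a power of $\omega$, and $(|\pi(1)|,\dots,|\pi(n)|)$ is a permutation of $\{1,\dots,n\}$. Extending by $\pi(\omega^a j)=\omega^a\pi(j)$, the product is composition $(\pi\sigma)(j)=\pi(\sigma(j))$. The group is generated by $s_0,\dots,s_{n-1}$, where $s_0(1)=\omega$, $s_0(j)=j$ for $2\le j\le n$, and, for $1\le i<n$, $s_i$ exchanges $i$ and $i+1$ and fixes all other $j\in\{1,\dots,n\}$. Flag major index: put $t_i:=s_i s_{i-1}\cdots s_1 s_0$ for $0\le i\le n-1$. Every $\pi\in C_m\wr S_n$ has a unique representation $\pi=t_{n-1}^{k_{n-1}}\cdots t_1^{k_1}t_0^{k_0}$ with integers $0\le k_i<m(i+1)$ for all $i$, and $\text{flag-major}(\pi):=\sum_{i=0}^{n-1}k_i$.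 Major index of a sequence: for a finite sequence $a=(a_1,\dots,a_n)$ of letters from a linearly ordered alphabet, $\text{major}(a)$ is the sum (possibly zero) of all indices $1\le i<n$ with $a_i>a_{i+1}$; $\text{major}(\pi)$ is the major index of the sequence $(\pi(1),\dots,\pi(n))$. *)

theory Defs
  imports "HOL-Analysis.Analysis" "HOL-Algebra.Group"
begin

definition primitive_unity_root :: "nat \<Rightarrow> complex \<Rightarrow> bool" where
  "primitive_unity_root m \<omega> \<longleftrightarrow> \<omega> ^ m = 1 \<and> (\<forall>k. 0 < k \<and> k < m \<longrightarrow> \<omega> ^ k \<noteq> 1)"

(* A generalized permutation is a map on {1..n}, normalised to be undefined elsewhere.
   The value 0 is excluded because of the condition on moduli. *)
definition gen_perms :: "complex \<Rightarrow> nat \<Rightarrow> (nat \<Rightarrow> complex) set" where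
  "gen_perms \<omega> n = {\<pi> \<in> extensional {1..n}.
     (\<forall>i\<in>{1..n}. \<exists>a::nat. \<pi> i / of_real (cmod (\<pi> i)) = \<omega> ^ a) \<and>
     bij_betw (\<lambda>i. cmod (\<pi> i)) {1..n} (real ` {1..n})}"

(* The extension of \<pi> to all letters: z = \<omega>^a j has modulus j and z / |z| = \<omega>^a,
   so the value at z is \<omega>^a \<pi>(j). *)
definition extend :: "(nat \<Rightarrow> complex) \<Rightarrow> complex \<Rightarrow> complex" where
  "extend \<pi> z = z / of_real (cmod z) * \<pi> (nat \<lfloor>cmod z\<rfloor>)"

(* The wreath product of C_m with S_n, for \<omega> a primitive m-th root of unity. *)
definition wreath :: "complex \<Rightarrow> nat \<Rightarrow> (nat \<Rightarrow> complex) monoid" where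
  "wreath \<omega> n =
     \<lparr>carrier = gen_perms \<omega> n,
      monoid.mult = (\<lambda>\<pi> \<sigma>. \<lambda>j\<in>{1..n}. extend \<pi> (\<sigma> j)),
      one = (\<lambda>j\<in>{1..n}. of_nat j)\<rparr>"

definition s_gen :: "complex \<Rightarrow> nat \<Rightarrow> nat \<Rightarrow> nat \<Rightarrow> complex" where
  "s_gen \<omega> n i = (\<lambda>j\<in>{1..n}.
     if i = 0 then (if j = 1 then \<omega> else of_nat j)
     else if j = i then of_nat (i + 1)
     else if j = i + 1 then of_nat i
     else of_nat j)"

primrec t_elt :: "complex \<Rightarrow> nat \<Rightarrow> nat \<Rightarrow> nat \<Rightarrow> complex" where
  "t_elt \<omega> n 0 = s_gen \<omega> n 0"
| "t_elt \<omega> n (Suc i) = s_gen \<omega> n (Suc i) \<otimes>\<^bsub>wreath \<omega> n\<^esub> t_elt \<omega> n i"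

(* t_prod \<omega> n k r = t_{r-1}^{k_{r-1}} ... t_1^{k_1} t_0^{k_0}, the largest index leftmost. *)
primrec t_prod :: "complex \<Rightarrow> nat \<Rightarrow> (nat \<Rightarrow> nat) \<Rightarrow> nat \<Rightarrow> nat \<Rightarrow> complex" where
  "t_prod \<omega> n k 0 = \<one>\<^bsub>wreath \<omega> n\<^esub>"
| "t_prod \<omega> n k (Suc r) =
     (t_elt \<omega> n r [^]\<^bsub>wreath \<omega> n\<^esub> k r) \<otimes>\<^bsub>wreath \<omega> n\<^esub> t_prod \<omega> n k r"

(* The exponents are taken as an extensional function on {..<n}, so that uniqueness of
   (k_0, ..., k_{n-1}) is uniqueness of k. *)
definition flag_exponents :: "nat \<Rightarrow> complex \<Rightarrow> nat \<Rightarrow> (nat \<Rightarrow> complex) \<Rightarrow> nat \<Rightarrow> nat" where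
  "flag_exponents m \<omega> n \<pi> =
     (THE k. k \<in> (\<Pi>\<^sub>E i\<in>{..<n}. {0..<m * (i + 1)}) \<and> \<pi> = t_prod \<omega> n k n)"

definition flag_major :: "nat \<Rightarrow> complex \<Rightarrow> nat \<Rightarrow> (nat \<Rightarrow> complex) \<Rightarrow> nat" where
  "flag_major m \<omega> n \<pi> = (\<Sum>i<n. flag_exponents m \<omega> n \<pi> i)"

(* Major index of (a 1, ..., a n) with respect to a strict order on the alphabet. *)
definition major :: "('a \<Rightarrow> 'a \<Rightarrow> bool) \<Rightarrow> nat \<Rightarrow> (nat \<Rightarrow> 'a) \<Rightarrow> nat" where
  "major lt n a = (\<Sum>i | 1 \<le> i \<and> i < n \<and> lt (a (i + 1)) (a i). i)"

(* The strict order
     1 \<omega>^(m-1) < ... < n \<omega>^(m-1) < ... < 1 \<omega>^1 < ... < n \<omega>^1 < 1 \<omega>^0 < ... < n \<omega>^0: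
   a larger exponent of \<omega> gives a smaller letter. *)
definition letter_less :: "nat \<Rightarrow> complex \<Rightarrow> nat \<Rightarrow> complex \<Rightarrow> complex \<Rightarrow> bool" where
  "letter_less m \<omega> n x y \<longleftrightarrow>
     (\<exists>a<m. \<exists>b<m. \<exists>j\<in>{1..n}. \<exists>k\<in>{1..n}.
        x = of_nat j * \<omega> ^ a \<and> y = of_nat k * \<omega> ^ b \<and> (b < a \<or> a = b \<and> j < k))"

end

theory Submission
  imports Defs "HOL-Number_Theory.Cong"
begin

text \<open>
  Number the \<open>m N\<close> letters \<open>\<omega>^a x\<close> with \<open>1 \<le> x \<le> N\<close> from the largest one downwards: the letter
  \<open>\<omega>^a x\<close> gets the code \<open>a N + (N - x)\<close>. The element \<open>t\<^bsub>N-1\<^esub>\<close> then acts on these letters as the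
  cyclic shift: it replaces every letter by its predecessor and the smallest letter
  \<open>\<omega>^(m-1) 1\<close> by the largest letter \<open>N\<close>, so it adds 1 to each code modulo \<open>m N\<close>
  (\<open>t_elt_letter\<close>, \<open>t_elt_pow\<close>, \<open>t_pow_mult_apply\<close>).

  The theorem rests on the fact that this shift, applied to all letters of \<open>\<pi>\<close>, raises the
  right-hand side by exactly 1 as long as \<open>\<pi>(N)\<close> is not the smallest letter
  (\<open>code_stat_rotate_Suc\<close>). If the smallest letter does not occur, no descent changes and exactly
  one letter, the one of modulus 1, gains a factor \<open>\<omega>\<close>. If it occurs at position \<open>p < N\<close>, it
  becomes the largest letter: the descent at \<open>p - 1\<close> (absent for \<open>p = 1\<close>) gives way to one at \<open>p\<close>,
  which contributes \<open>m\<close>, while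
  the exponent of that letter drops from \<open>m - 1\<close> to \<open>0\<close>; the total change is again
  \<open>m - (m - 1) = 1\<close>.

  Let \<open>L N\<close> be the subgroup of elements fixing \<open>N + 1, \<dots>, n\<close> (\<open>fixing_above\<close>). An element of
  \<open>L (N - 1)\<close>, viewed in \<open>L N\<close>, has last letter \<open>N\<close>, whose code is \<open>0\<close>. Multiplying by the power
  \<open>t\<^bsub>N-1\<^esub>^k\<close> with \<open>k < m N\<close> turns this code into \<open>k\<close> without ever shifting the smallest letter away
  from the last position, so the statistic grows by \<open>k\<close> (\<open>colored_major_t_pow_mult\<close>). Since an
  appended largest letter does not alter the statistic (\<open>colored_major_Suc\<close>), induction on \<open>N\<close>
  gives the sum of the exponents. The same observation yields existence and uniqueness of the
  exponents: the last letter of an element of \<open>L N\<close> has a code, this code has to be the exponent of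
  \<open>t\<^bsub>N-1\<^esub>\<close>, and undoing the shift leaves an element of \<open>L (N - 1)\<close>
  (\<open>t_prod_surj\<close>, \<open>t_prod_inj\<close>).
\<close>

section \<open>The statistic on sequences of codes\<close>

text \<open>
  Smaller codes belong to larger letters, so a descent of letters is an ascent of codes; the
  exponent of \<open>\<omega>\<close> in the letter with code \<open>c\<close> is \<open>c div N\<close>.
\<close>
definition code_stat :: "nat \<Rightarrow> nat \<Rightarrow> (nat \<Rightarrow> nat) \<Rightarrow> nat" where
  "code_stat m N c =
     m * (\<Sum>i | 1 \<le> i \<and> i < N \<and> c i < c (i + 1). i) + (\<Sum>i = 1..N. c i div N)"

lemma inj_on_mod_shift:
  fixes c :: "nat \<Rightarrow> nat"
  shows "inj_on (\<lambda>i. c i mod N) A \<Longrightarrow> inj_on (\<lambda>i. (c i + k) mod N) A"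
  by (simp add: inj_on_def cong_add_rcancel_nat[unfolded cong_def])

text \<open>
  Exactly one position \<open>p\<close> has a code congruent to \<open>N - 1\<close>, that is a letter of modulus 1. Away
  from \<open>p\<close> neither the exponents nor the relative order of the codes change, so everything depends on
  whether the code at \<open>p\<close> wraps around. If it does, it turns from the maximum into the minimum: the
  code ascent ending at \<open>p\<close>, present when \<open>p > 1\<close>, is replaced by one starting at \<open>p\<close>.
\<close>
lemma code_stat_rotate_Suc:
  assumes c: "\<And>i. i \<in> {1..N} \<Longrightarrow> c i < m * N"
    and inj: "inj_on (\<lambda>i. c i mod N) {1..N}"
    and N: "N \<ge> 1" and last: "c N + 1 < m * N"
  shows "code_stat m N (\<lambda>i. (c i + 1) mod (m * N)) = code_stat m N c + 1"
proof -
  let ?c' = "\<lambda>i. (c i + 1) mod (m * N)"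
  let ?D = "\<lambda>c::nat \<Rightarrow> nat. {i. 1 \<le> i \<and> i < N \<and> c i < c (i + 1)}"
  have m: "m \<ge> 1" using last by (cases m) auto
  have fin: "finite (?D f)" for f :: "nat \<Rightarrow> nat" by (rule finite_subset[of _ "{1..N}"]) auto
  have "(\<lambda>i. c i mod N) ` {1..N} = {0..<N}"
    by (rule card_subset_eq) (use N card_image[OF inj] in auto)
  then obtain p where p: "p \<in> {1..N}" "c p mod N = N - 1"
    using N by (auto simp: image_iff set_eq_iff dest!: spec[of _ "N - 1"])
  have other_mod: "c i mod N \<noteq> N - 1" if "i \<in> {1..N}" "i \<noteq> p" for i
    using that p inj_onD[OF inj, of i p] by auto
  have top_mod: "(m * N - 1) mod N = N - 1" and top_div: "(m * N - 1) div N = m - 1"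
  proof -
    have e: "m * N - 1 = (N - 1) + (m - 1) * N" using m N by (cases m) (auto simp: algebra_simps)
    show "(m * N - 1) mod N = N - 1" unfolding e mod_mult_self1 using N by simp
    show "(m * N - 1) div N = m - 1" unfolding e using N by (subst div_mult_self1) auto
  qed
  have small: "c i + 1 < m * N" if "i \<in> {1..N}" "i \<noteq> p" for i
  proof -
    have "c i \<noteq> m * N - 1" using other_mod[OF that] top_mod by metis
    then show ?thesis using c[OF that(1)] by linarith
  qed
  have other: "?c' i = c i + 1" "?c' i div N = c i div N" if "i \<in> {1..N}" "i \<noteq> p" for i
  proof -
    show e: "?c' i = c i + 1" using small[OF that] by simp
    have "Suc (c i mod N) \<noteq> N" using other_mod[OF that] by auto
    then show "?c' i div N = c i div N" using e N by (simp add: div_Suc mod_Suc)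
  qed
  have p_div: "(c p + 1) div N = c p div N + 1"
    using p N by (simp add: div_Suc mod_Suc)
  have split: "(\<Sum>i = 1..N. f i) = f p + (\<Sum>i \<in> {1..N} - {p}. f i)" for f :: "nat \<Rightarrow> nat"
    using p by (simp add: sum.remove)
  have rest: "(\<Sum>i \<in> {1..N} - {p}. ?c' i div N) = (\<Sum>i \<in> {1..N} - {p}. c i div N)"
    by (rule sum.cong) (use other in auto)
  show ?thesis
  proof (cases "c p + 1 < m * N")
    case True
    then have all: "?c' i = c i + 1" if "i \<in> {1..N}" for i using small[of i] that by (cases "i = p") auto
    have "?D ?c' = ?D c" using all by auto
    moreover have "(\<Sum>i = 1..N. ?c' i div N) = (\<Sum>i = 1..N. c i div N) + 1"
      using True p_div by (simp only: split rest) simp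
    ultimately show ?thesis unfolding code_stat_def by simp
  next
    case False
    then have cp: "c p = m * N - 1" using c[OF p(1)] by linarith
    have pN: "p < N" using p last cp by (cases "p = N") auto
    have c'p: "?c' p = 0" using cp m N by simp
    have below: "c i < c p" if "i \<in> {1..N}" "i \<noteq> p" for i using small[OF that] cp by linarith
    have D': "?D ?c' = insert p (?D c - {p - 1})"
    proof (rule Set.set_eqI)
      fix i
      show "i \<in> ?D ?c' \<longleftrightarrow> i \<in> insert p (?D c - {p - 1})"
      proof (cases "i \<in> {1..N} \<and> i < N")
        case True
        consider "i = p" | "i + 1 = p" | "i \<noteq> p" "i + 1 \<noteq> p" by blast
        then show ?thesis
        proof cases
          case 1 then show ?thesis using c'p other(1)[of "i + 1"] pN p(1) by simp
        next
          case 2 then show ?thesis using c'p p(1) by auto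
        next
          case 3 then show ?thesis using other(1)[of i] other(1)[of "i + 1"] True p(1) by auto
        qed
      next
        case False then show ?thesis using p(1) pN by auto
      qed
    qed
    have pD: "p \<notin> ?D c" using below[of "p + 1"] pN p(1) by auto
    \<comment> \<open>For \<open>p = 1\<close> there is no position before \<open>p\<close>, but then \<open>p - 1 = 0\<close> adds nothing to the sum.\<close>
    have "p - 1 \<in> ?D c" if "p - 1 \<noteq> 0"
    proof -
      have "p - 1 \<in> {1..N}" "p - 1 \<noteq> p" "p - 1 + 1 = p" using that p(1) by auto
      then show ?thesis using below[of "p - 1"] pN by simp
    qed
    then have rm: "\<Sum>(?D c) = (p - 1) + \<Sum>(?D c - {p - 1})"
      using sum.remove[OF fin[of c], of "p - 1" "\<lambda>i. i"] by (cases "p - 1 = 0") auto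
    have D: "\<Sum>(?D ?c') = \<Sum>(?D c) + 1"
    proof -
      have "\<Sum>(insert p (?D c - {p - 1})) = p + \<Sum>(?D c - {p - 1})"
        using fin[of c] pD by (intro sum.insert) blast+
      then show ?thesis unfolding D' using rm p(1) by simp
    qed
    have "c p div N = m - 1" using cp top_div by simp
    then have "(\<Sum>i = 1..N. c i div N) = (\<Sum>i = 1..N. ?c' i div N) + (m - 1)"
      by (simp only: split rest c'p) simp
    then show ?thesis unfolding code_stat_def using D m by (simp add: algebra_simps)
  qed
qed

text \<open>
  Starting from \<open>0\<close>, the last code runs through \<open>0, \<dots>, k\<close> and stays below \<open>m * N - 1\<close> before
  each of the \<open>k\<close> single steps.
\<close>
lemma code_stat_rotate:
  assumes c: "\<And>i. i \<in> {1..N} \<Longrightarrow> c i < m * N"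
    and inj: "inj_on (\<lambda>i. c i mod N) {1..N}"
    and N: "N \<ge> 1" and last: "c N = 0" and k: "k < m * N"
  shows "code_stat m N (\<lambda>i. (c i + k) mod (m * N)) = code_stat m N c + k"
  using k
proof (induction k)
  case 0
  have "(\<Sum>i | 1 \<le> i \<and> i < N \<and> (c i) mod (m * N) < c (i + 1) mod (m * N). i)
      = (\<Sum>i | 1 \<le> i \<and> i < N \<and> c i < c (i + 1). i)"
    by (rule sum.cong) (use c in auto)
  moreover have "(\<Sum>i = 1..N. (c i mod (m * N)) div N) = (\<Sum>i = 1..N. c i div N)"
    by (rule sum.cong) (use c in auto)
  ultimately show ?case by (simp add: code_stat_def)
next
  case (Suc k)
  let ?c = "\<lambda>i. (c i + k) mod (m * N)"
  have "inj_on (\<lambda>i. ?c i mod N) {1..N}"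
    using inj_on_mod_shift[OF inj, of k] by (simp add: mod_mod_cancel)
  then have "code_stat m N (\<lambda>i. (?c i + 1) mod (m * N)) = code_stat m N ?c + 1"
    using N
  proof (intro code_stat_rotate_Suc)
    have "0 < m * N" using Suc.prems by linarith
    then show "?c i < m * N" for i by (rule mod_less_divisor)
    show "?c N + 1 < m * N" using last Suc.prems by simp
  qed
  then show ?case using Suc by (simp add: mod_simps)
qed

section \<open>Letters and their codes\<close>

locale primitive_root =
  fixes m :: nat and \<omega> :: complex
  assumes m: "m \<ge> 1" and primitive: "primitive_unity_root m \<omega>"
begin

text \<open>
  The moduli \<open>N - c mod N\<close> of letters are natural numbers and are kept as such under \<open>of_nat\<close>, so
  that \<open>norm_colored\<close> and \<open>colored_eq_iff\<close> apply to them.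
\<close>
declare of_nat_diff [simp del]

text \<open>
  Codes are not restricted to \<open>{0..<m * N}\<close>: since \<open>\<omega> ^ m = 1\<close>, the formula is periodic with period
  \<open>m * N\<close>, and shifts of codes can be written as plain additions.
\<close>
definition letter :: "nat \<Rightarrow> nat \<Rightarrow> complex" where
  "letter N c = \<omega> ^ (c div N) * of_nat (N - c mod N)"

lemma power_m: "\<omega> ^ m = 1"
  using primitive by (simp add: primitive_unity_root_def)

lemma norm_root: "cmod \<omega> = 1"
proof -
  have "cmod \<omega> ^ m = 1" using power_m by (metis norm_one norm_power)
  then show ?thesis using m power_eq_imp_eq_base[of "cmod \<omega>" m 1] by simp
qed

lemma root_nonzero: "\<omega> \<noteq> 0"
  using norm_root by auto

lemma power_eq_mod: "\<omega> ^ a = \<omega> ^ (a mod m)"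
proof -
  have "\<omega> ^ a = \<omega> ^ (m * (a div m) + a mod m)" by simp
  also have "\<dots> = \<omega> ^ (a mod m)" unfolding power_add power_mult by (simp add: power_m)
  finally show ?thesis .
qed

lemma power_eq_iff:
  assumes "a < m" "b < m"
  shows "\<omega> ^ a = \<omega> ^ b \<longleftrightarrow> a = b"
proof -
  have *: False if "x < y" "y < m" "\<omega> ^ x = \<omega> ^ y" for x y
  proof -
    have "\<omega> ^ x * \<omega> ^ (y - x) = \<omega> ^ y" using that(1) unfolding power_add[symmetric] by simp
    then have "\<omega> ^ x * \<omega> ^ (y - x) = \<omega> ^ x" using that(3) by simp
    then have "\<omega> ^ (y - x) = 1" using root_nonzero by simp
    moreover have "0 < y - x \<and> y - x < m" using that by linarith
    ultimately show False using primitive unfolding primitive_unity_root_def by blast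
  qed
  show ?thesis using *[of a b] *[of b a] assms by (metis nat_neq_iff)
qed

lemma norm_colored [simp]: "cmod (\<omega> ^ a * of_nat x) = real x"
  by (simp add: norm_mult norm_power norm_root)

lemma colored_eq_iff:
  assumes "a < m" "b < m" "x \<ge> 1"
  shows "\<omega> ^ a * of_nat x = \<omega> ^ b * of_nat y \<longleftrightarrow> a = b \<and> x = y"
proof
  assume eq: "\<omega> ^ a * of_nat x = \<omega> ^ b * of_nat y"
  then have "x = y" using norm_colored by (metis of_nat_eq_iff)
  then show "a = b \<and> x = y" using eq assms power_eq_iff by auto
qed simp

lemma color_div: "x \<ge> 1 \<Longrightarrow> (\<omega> ^ a * of_nat x) / of_real (cmod (\<omega> ^ a * of_nat x)) = \<omega> ^ a"
  by (simp only: norm_colored) simp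

lemma extend_colored:
  "x \<ge> 1 \<Longrightarrow> extend f (\<omega> ^ a * of_nat x) = \<omega> ^ a * f x"
  unfolding extend_def by (simp only: color_div) (simp only: norm_colored floor_of_nat nat_int)

lemma extend_of_nat: "x \<ge> 1 \<Longrightarrow> extend f (of_nat x) = f x"
  using extend_colored[of x f 0] by simp

lemma letter_add_mult:
  assumes "N \<ge> 1"
  shows "letter N (q * N + c) = \<omega> ^ q * letter N c"
proof -
  have "(q * N + c) div N = q + c div N" "(q * N + c) mod N = c mod N" using assms by auto
  then show ?thesis by (simp only: letter_def power_add mult.assoc)
qed

text \<open>
  The extension commutes with multiplication by powers of \<open>\<omega>\<close>, so a map that shifts the codes of
  the letters \<open>1, \<dots>, N\<close> shifts all codes.
\<close>
lemma extend_letter: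
  assumes "N \<ge> 1" and "\<And>b. b < N \<Longrightarrow> f (N - b) = letter N (b + k)"
  shows "extend f (letter N c) = letter N (c + k)"
proof -
  have "extend f (letter N c) = \<omega> ^ (c div N) * letter N (c mod N + k)"
    using assms by (simp add: letter_def extend_colored[of "N - c mod N"] Suc_leI)
  also have "\<dots> = letter N (c div N * N + (c mod N + k))"
    by (simp only: letter_add_mult[OF assms(1)])
  also have "c div N * N + (c mod N + k) = c + k" by simp
  finally show ?thesis .
qed

lemma letter_mod:
  assumes "N \<ge> 1" shows "letter N c = letter N (c mod (m * N))"
proof -
  have "c mod (m * N) div N = c div N mod m"
    using assms m by (simp add: mod_mult2_eq mult.commute[of m])
  then show ?thesis unfolding letter_def using power_eq_mod[of "c div N"]
    by (simp add: mod_mod_cancel)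
qed

lemma div_less_m: "c < m * N \<Longrightarrow> c div N < m"
  by (simp add: less_mult_imp_div_less)

lemma letter_eq_iff:
  assumes "N \<ge> 1"
  shows "letter N c = letter N d \<longleftrightarrow> c mod (m * N) = d mod (m * N)"
proof
  let ?c = "c mod (m * N)" and ?d = "d mod (m * N)"
  assume "letter N c = letter N d"
  then have "letter N ?c = letter N ?d" using letter_mod[OF assms] by simp
  moreover have "?c < m * N" "?d < m * N" using m assms by auto
  ultimately have "?c div N = ?d div N \<and> N - ?c mod N = N - ?d mod N"
    unfolding letter_def using assms
    by (subst (asm) colored_eq_iff) (auto simp: div_less_m Suc_leI)
  moreover have "?c mod N < N" "?d mod N < N" using assms by auto
  ultimately have "?c div N = ?d div N" "?c mod N = ?d mod N" by linarith+
  then show "?c = ?d" by (metis div_mult_mod_eq)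
qed (metis letter_mod assms)

text \<open>
  Codes order the letters lexicographically, first by the exponent of \<open>\<omega>\<close> and then by decreasing
  modulus; both comparisons are opposite to those of the letters.
\<close>
lemma letter_less_iff:
  assumes N: "1 \<le> N" "N \<le> n" and c: "c < m * N" and d: "d < m * N"
  shows "letter_less m \<omega> n (letter N c) (letter N d) \<longleftrightarrow> d < c"
proof -
  have modN: "c mod N < N" "d mod N < N" using N by auto
  have "letter_less m \<omega> n (letter N c) (letter N d) \<longleftrightarrow>
      d div N < c div N \<or> c div N = d div N \<and> N - c mod N < N - d mod N" (is "?L \<longleftrightarrow> ?R")
  proof
    assume ?L
    then obtain a b j k where *: "a < m" "b < m" "j \<in> {1..n}" "k \<in> {1..n}"
      "letter N c = of_nat j * \<omega> ^ a" "letter N d = of_nat k * \<omega> ^ b" "b < a \<or> a = b \<and> j < k"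
      unfolding letter_less_def by blast
    have "c div N = a \<and> N - c mod N = j" "d div N = b \<and> N - d mod N = k"
      using * modN c d
      by (auto simp: letter_def mult.commute[of "of_nat j"] mult.commute[of "of_nat k"]
          colored_eq_iff div_less_m Suc_leI)
    then show ?R using * by auto
  next
    assume ?R
    moreover have "N - c mod N \<in> {1..n}" "N - d mod N \<in> {1..n}" using modN N by (auto simp: Suc_le_eq)
    moreover have "letter N c = of_nat (N - c mod N) * \<omega> ^ (c div N)"
      "letter N d = of_nat (N - d mod N) * \<omega> ^ (d div N)" by (simp_all add: letter_def)
    ultimately show ?L unfolding letter_less_def
      using div_less_m[OF c] div_less_m[OF d] by blast
  qed
  also have "\<dots> \<longleftrightarrow> d < c"
  proof -
    have "(N - c mod N < N - d mod N) \<longleftrightarrow> d mod N < c mod N" using modN by linarith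
    moreover have "d < c \<longleftrightarrow> d div N < c div N \<or> c div N = d div N \<and> d mod N < c mod N"
    proof -
      have "c div N \<le> d div N" if "c \<le> d" using that by (rule div_le_mono)
      moreover have "d div N \<le> c div N" if "d \<le> c" using that by (rule div_le_mono)
      moreover have "c = c div N * N + c mod N" "d = d div N * N + d mod N" by simp_all
      ultimately show ?thesis by (metis add_less_cancel_left le_neq_implies_less less_imp_le not_le)
    qed
    ultimately show ?thesis by simp
  qed
  finally show ?thesis .
qed

section \<open>Powers of the flag generators\<close>

lemma t_elt_apply:
  assumes "r < n" "j \<in> {1..n}"
  shows "t_elt \<omega> n r j =
    (if j = 1 then \<omega> * of_nat (r + 1) else if j \<le> r + 1 then of_nat (j - 1) else of_nat j)"
  using assms
proof (induction r arbitrary: j)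
  case 0
  then show ?case by (auto simp: s_gen_def)
next
  case (Suc r)
  have s_first: "extend (s_gen \<omega> n (Suc r)) (\<omega> * of_nat (r + 1)) = \<omega> * of_nat (r + 2)"
    using extend_colored[of "r + 1" "s_gen \<omega> n (Suc r)" 1] Suc.prems by (simp add: s_gen_def)
  have s_plain: "extend (s_gen \<omega> n (Suc r)) (of_nat x) = s_gen \<omega> n (Suc r) x" if "x \<ge> 1" for x
    using that by (rule extend_of_nat)
  have "t_elt \<omega> n (Suc r) j = extend (s_gen \<omega> n (Suc r)) (t_elt \<omega> n r j)"
    using Suc.prems by (simp add: wreath_def)
  also have "\<dots> = (if j = 1 then \<omega> * of_nat (Suc r + 1)
      else if j \<le> Suc r + 1 then of_nat (j - 1) else of_nat j)"
  proof -
    consider "j = 1" | "1 < j" "j \<le> r + 1" | "j > r + 1" using Suc.prems by force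
    then show ?thesis
    proof cases
      case 1
      then show ?thesis using Suc s_first by simp
    next
      case 2
      then have "t_elt \<omega> n r j = of_nat (j - 1)" using Suc by simp
      then show ?thesis using 2 Suc.prems s_plain[of "j - 1"] by (auto simp: s_gen_def)
    next
      case 3
      then have "t_elt \<omega> n r j = of_nat j" using Suc by simp
      then show ?thesis using 3 Suc.prems s_plain[of j]
        by (cases "j = r + 2") (auto simp: s_gen_def)
    qed
  qed
  finally show ?case .
qed

text \<open>
  The code of \<open>j\<close> is \<open>r + 1 - j\<close>, so this is a shift by one. For \<open>j = 1\<close> the code \<open>r + 1\<close> overflows
  into the next power of \<open>\<omega>\<close>, which accounts for \<open>t\<^sub>r(1) = \<omega> (r + 1)\<close>.
\<close>
lemma t_elt_letter:
  assumes "r < n" "j \<in> {1..n}"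
  shows "t_elt \<omega> n r j = (if j \<le> r + 1 then letter (r + 1) (r + 1 - j + 1) else of_nat j)"
proof -
  consider "j = 1" | "1 < j" "j \<le> r + 1" | "j > r + 1" using assms by force
  then show ?thesis
  proof cases
    case 2
    then have "r + 1 - j + 1 < r + 1" "r + 1 - (r + 1 - j + 1) = j - 1" by linarith+
    then have "letter (r + 1) (r + 1 - j + 1) = of_nat (j - 1)" unfolding letter_def by simp
    then show ?thesis using 2 by (subst t_elt_apply[OF assms]) simp
  qed (subst t_elt_apply[OF assms], simp add: letter_def)+
qed

lemma t_elt_pow:
  assumes "r < n"
  shows "t_elt \<omega> n r [^]\<^bsub>wreath \<omega> n\<^esub> k =
    (\<lambda>j\<in>{1..n}. if j \<le> r + 1 then letter (r + 1) (r + 1 - j + k) else of_nat j)"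
proof (induction k)
  case 0
  have "letter (r + 1) (r + 1 - j) = of_nat j" if "1 \<le> j" "j \<le> r + 1" for j
    using that by (simp add: letter_def)
  then show ?case by (auto simp: wreath_def fun_eq_iff)
next
  case (Suc k)
  let ?f = "\<lambda>j\<in>{1..n}. if j \<le> r + 1 then letter (r + 1) (r + 1 - j + k) else of_nat j"
  have "extend ?f (letter (r + 1) c) = letter (r + 1) (c + k)" for c
    by (rule extend_letter) (use assms in auto)
  then have "extend ?f (t_elt \<omega> n r j) =
      (if j \<le> r + 1 then letter (r + 1) (r + 1 - j + Suc k) else of_nat j)" if "j \<in> {1..n}" for j
    using that extend_of_nat[of j ?f] by (subst t_elt_letter[OF assms that]) auto
  then have *: "(\<lambda>j\<in>{1..n}. extend ?f (t_elt \<omega> n r j)) =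
    (\<lambda>j\<in>{1..n}. if j \<le> r + 1 then letter (r + 1) (r + 1 - j + Suc k) else of_nat j)"
    by (auto simp: fun_eq_iff)
  have "t_elt \<omega> n r [^]\<^bsub>wreath \<omega> n\<^esub> Suc k = ?f \<otimes>\<^bsub>wreath \<omega> n\<^esub> t_elt \<omega> n r"
    unfolding Suc[symmetric] by (simp add: nat_pow_def)
  also have "\<dots> = (\<lambda>j\<in>{1..n}. extend ?f (t_elt \<omega> n r j))" by (simp add: wreath_def)
  finally show ?case using * by (rule trans)
qed

section \<open>The chain of subgroups\<close>

text \<open>
  The subgroup of elements fixing all \<open>i > N\<close>. On \<open>{1..N}\<close> the moduli take values in
  \<open>{1..N}\<close>, so their injectivity already makes them a permutation. The exponents are arbitrary
  natural numbers, so that shifts of codes can be applied without reducing them.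
\<close>
definition fixing_above :: "nat \<Rightarrow> nat \<Rightarrow> (nat \<Rightarrow> complex) set" where
  "fixing_above n N = {\<sigma> \<in> extensional {1..n}.
     (\<forall>i\<in>{1..N}. \<exists>a. \<exists>x\<in>{1..N}. \<sigma> i = \<omega> ^ a * of_nat x) \<and>
     inj_on (\<lambda>i. cmod (\<sigma> i)) {1..N} \<and> (\<forall>i\<in>{N<..n}. \<sigma> i = of_nat i)}"

lemma carrier_fixing_above: "carrier (wreath \<omega> n) \<subseteq> fixing_above n n"
proof
  fix \<pi> assume "\<pi> \<in> carrier (wreath \<omega> n)"
  then have ext: "\<pi> \<in> extensional {1..n}"
    and col: "\<And>i. i \<in> {1..n} \<Longrightarrow> \<exists>a::nat. \<pi> i / of_real (cmod (\<pi> i)) = \<omega> ^ a"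
    and bij: "bij_betw (\<lambda>i. cmod (\<pi> i)) {1..n} (real ` {1..n})"
    by (auto simp: wreath_def gen_perms_def)
  have "\<exists>a. \<exists>x\<in>{1..n}. \<pi> i = \<omega> ^ a * of_nat x" if i: "i \<in> {1..n}" for i
  proof -
    obtain x where x: "x \<in> {1..n}" "cmod (\<pi> i) = real x"
      using bspec[OF bij_betwE[OF bij] i] by (auto simp only: image_iff)
    obtain a :: nat where a: "\<pi> i / of_real (cmod (\<pi> i)) = \<omega> ^ a" using col[OF i] ..
    have "\<pi> i = \<pi> i / of_nat x * of_nat x" using x(1) by simp
    also have "\<pi> i / of_nat x = \<omega> ^ a" using a unfolding x(2) by simp
    finally have "\<pi> i = \<omega> ^ a * of_nat x" .
    then show ?thesis using x by blast
  qed
  then show "\<pi> \<in> fixing_above n n"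
    using ext bij by (auto simp: fixing_above_def bij_betw_def)
qed

lemma fixing_above_entry:
  assumes "\<sigma> \<in> fixing_above n N" "i \<in> {1..N}"
  obtains a x where "x \<in> {1..N}" "\<sigma> i = \<omega> ^ a * of_nat x"
proof -
  have "\<forall>i\<in>{1..N}. \<exists>a. \<exists>x\<in>{1..N}. \<sigma> i = \<omega> ^ a * of_nat x"
    using assms(1) by (simp add: fixing_above_def)
  then show ?thesis using assms(2) that by meson
qed

text \<open>
  If \<open>N + 1\<close> is fixed, injectivity keeps the modulus \<open>N + 1\<close> away from the other positions.
\<close>
lemma fixing_above_Suc:
  assumes "N < n"
  shows "\<sigma> \<in> fixing_above n N \<longleftrightarrow> \<sigma> \<in> fixing_above n (Suc N) \<and> \<sigma> (Suc N) = of_nat (Suc N)"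
proof
  assume L: "\<sigma> \<in> fixing_above n N"
  then have last: "\<sigma> (Suc N) = of_nat (Suc N)" using assms by (auto simp: fixing_above_def)
  have "cmod (\<sigma> i) \<noteq> real (Suc N)" if i: "i \<in> {1..N}" for i
  proof -
    obtain a x where x: "x \<in> {1..N}" "\<sigma> i = \<omega> ^ a * of_nat x"
      using fixing_above_entry[OF L i] .
    have "cmod (\<sigma> i) = real x" unfolding x(2) by (rule norm_colored)
    then show ?thesis using x(1) by auto
  qed
  moreover have "cmod (\<sigma> (Suc N)) = real (Suc N)" unfolding last by (rule norm_of_nat)
  ultimately have "inj_on (\<lambda>i. cmod (\<sigma> i)) (insert (Suc N) {1..N})"
    using L by (auto simp: fixing_above_def simp del: of_nat_Suc)
  then have "inj_on (\<lambda>i. cmod (\<sigma> i)) {1..Suc N}" by (simp add: atLeastAtMostSuc_conv)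
  moreover have "\<exists>a. \<exists>x\<in>{1..Suc N}. \<sigma> i = \<omega> ^ a * of_nat x" if "i \<in> {1..Suc N}" for i
  proof (cases "i = Suc N")
    case True
    then have "\<sigma> i = \<omega> ^ 0 * of_nat (Suc N)" using last by simp
    then show ?thesis by (metis True that)
  next
    case False
    then have "i \<in> {1..N}" using that by auto
    then obtain a x where "x \<in> {1..N}" "\<sigma> i = \<omega> ^ a * of_nat x"
      using fixing_above_entry[OF L] by metis
    then show ?thesis by fastforce
  qed
  moreover have "\<sigma> \<in> extensional {1..n}" "\<forall>i\<in>{Suc N<..n}. \<sigma> i = of_nat i"
    using L by (auto simp: fixing_above_def)
  ultimately show "\<sigma> \<in> fixing_above n (Suc N) \<and> \<sigma> (Suc N) = of_nat (Suc N)"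
    using last unfolding fixing_above_def mem_Collect_eq by blast
next
  assume *: "\<sigma> \<in> fixing_above n (Suc N) \<and> \<sigma> (Suc N) = of_nat (Suc N)"
  then have inj: "inj_on (\<lambda>i. cmod (\<sigma> i)) {1..Suc N}" by (simp add: fixing_above_def)
  have "\<exists>a. \<exists>x\<in>{1..N}. \<sigma> i = \<omega> ^ a * of_nat x" if "i \<in> {1..N}" for i
  proof -
    have "i \<in> {1..Suc N}" using that by auto
    then obtain a x where x: "x \<in> {1..Suc N}" "\<sigma> i = \<omega> ^ a * of_nat x"
      using fixing_above_entry[of \<sigma> n "Suc N" i] * by metis
    have "cmod (\<sigma> i) = real x" by (subst x(2)) (rule norm_colored)
    moreover have "cmod (\<sigma> (Suc N)) = real (Suc N)" using * norm_of_nat by metis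
    moreover have "cmod (\<sigma> i) \<noteq> cmod (\<sigma> (Suc N))"
      using inj_onD[OF inj, of i "Suc N"] that by auto
    ultimately have "x \<noteq> Suc N" by metis
    then have "x \<in> {1..N}" using x(1) by auto
    then show ?thesis using x(2) by blast
  qed
  moreover have "\<sigma> i = of_nat i" if "i \<in> {N<..n}" for i
    using * that by (cases "i = Suc N") (auto simp: fixing_above_def)
  ultimately show "\<sigma> \<in> fixing_above n N"
    using * inj_on_subset[OF inj, of "{1..N}"] by (auto simp: fixing_above_def)
qed

lemma fixing_above_codes:
  assumes "\<sigma> \<in> fixing_above n N"
  obtains c where "\<And>i. i \<in> {1..N} \<Longrightarrow> c i < m * N" "\<And>i. i \<in> {1..N} \<Longrightarrow> \<sigma> i = letter N (c i)"
    "inj_on (\<lambda>i. c i mod N) {1..N}"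
proof -
  have "\<exists>d. d < m * N \<and> \<sigma> i = letter N d" if i: "i \<in> {1..N}" for i
  proof -
    obtain a x where x: "x \<in> {1..N}" "\<sigma> i = \<omega> ^ a * of_nat x"
      using fixing_above_entry[OF assms i] .
    have "letter N (N - x) = of_nat x" using x(1) by (simp add: letter_def)
    then have "letter N (a * N + (N - x)) = \<sigma> i" using letter_add_mult[of N a "N - x"] x by simp
    then have "\<sigma> i = letter N ((a * N + (N - x)) mod (m * N))"
      using x letter_mod[of N "a * N + (N - x)"] by simp
    moreover have "(a * N + (N - x)) mod (m * N) < m * N" using x m by simp
    ultimately show ?thesis by blast
  qed
  then obtain c where c: "\<And>i. i \<in> {1..N} \<Longrightarrow> c i < m * N \<and> \<sigma> i = letter N (c i)" by metis
  have "inj_on (\<lambda>i. c i mod N) {1..N}"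
  proof (rule inj_onI)
    fix i j assume ij: "i \<in> {1..N}" "j \<in> {1..N}" and eq: "c i mod N = c j mod N"
    have "cmod (\<sigma> i) = cmod (\<sigma> j)"
      using c[OF ij(1)] c[OF ij(2)] eq by (simp only: letter_def norm_colored)
    moreover have "inj_on (\<lambda>i. cmod (\<sigma> i)) {1..N}" using assms by (simp add: fixing_above_def)
    ultimately show "i = j" using ij by (auto dest: inj_onD)
  qed
  then show ?thesis using that[of c] c by simp
qed

lemma codes_fixing_above:
  assumes N: "N \<ge> 1"
    and "\<sigma> \<in> extensional {1..n}" "\<And>i. i \<in> {N<..n} \<Longrightarrow> \<sigma> i = of_nat i"
    and \<sigma>: "\<And>i. i \<in> {1..N} \<Longrightarrow> \<sigma> i = letter N (c i)"
    and inj: "inj_on (\<lambda>i. c i mod N) {1..N}"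
  shows "\<sigma> \<in> fixing_above n N"
proof -
  have "\<exists>a. \<exists>x\<in>{1..N}. \<sigma> i = \<omega> ^ a * of_nat x" if "i \<in> {1..N}" for i
  proof (intro exI bexI)
    show "\<sigma> i = \<omega> ^ (c i div N) * of_nat (N - c i mod N)" using \<sigma>[OF that] by (simp add: letter_def)
  qed (use N in \<open>simp add: Suc_leI\<close>)
  moreover have "inj_on (\<lambda>i. cmod (\<sigma> i)) {1..N}"
  proof (rule inj_onI)
    fix i j assume ij: "i \<in> {1..N}" "j \<in> {1..N}" and "cmod (\<sigma> i) = cmod (\<sigma> j)"
    then have "N - c i mod N = N - c j mod N"
      by (simp only: \<sigma> letter_def norm_colored of_nat_eq_iff)
    moreover have "c i mod N < N" "c j mod N < N" using N by auto
    ultimately have "c i mod N = c j mod N" by linarith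
    then show "i = j" using inj_onD[OF inj _ ij] by simp
  qed
  ultimately show ?thesis using assms(2,3) by (simp add: fixing_above_def)
qed

text \<open>
  Left multiplication acts on the values of \<open>\<sigma>\<close>, hence by shifting their codes. The second
  rule covers the positions that the whole subgroup generated by \<open>t\<^sub>0, \<dots>, t\<^sub>r\<close> fixes.
\<close>
lemma t_pow_mult_apply:
  assumes "r < n" "i \<in> {1..n}"
  shows "i \<le> r + 1 \<Longrightarrow> \<sigma> i = letter (r + 1) d \<Longrightarrow>
      (t_elt \<omega> n r [^]\<^bsub>wreath \<omega> n\<^esub> k \<otimes>\<^bsub>wreath \<omega> n\<^esub> \<sigma>) i = letter (r + 1) (d + k)"
    and "r + 1 < i \<Longrightarrow> \<sigma> i = of_nat i \<Longrightarrow>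
      (t_elt \<omega> n r [^]\<^bsub>wreath \<omega> n\<^esub> k \<otimes>\<^bsub>wreath \<omega> n\<^esub> \<sigma>) i = of_nat i"
proof -
  let ?f = "\<lambda>j\<in>{1..n}. if j \<le> r + 1 then letter (r + 1) (r + 1 - j + k) else of_nat j"
  have *: "(t_elt \<omega> n r [^]\<^bsub>wreath \<omega> n\<^esub> k \<otimes>\<^bsub>wreath \<omega> n\<^esub> \<sigma>) i = extend ?f (\<sigma> i)"
    using assms(2) unfolding t_elt_pow[OF assms(1)] by (simp add: wreath_def)
  have "extend ?f (letter (r + 1) d) = letter (r + 1) (d + k)"
    by (rule extend_letter) (use assms in auto)
  then show "i \<le> r + 1 \<Longrightarrow> \<sigma> i = letter (r + 1) d \<Longrightarrow>
      (t_elt \<omega> n r [^]\<^bsub>wreath \<omega> n\<^esub> k \<otimes>\<^bsub>wreath \<omega> n\<^esub> \<sigma>) i = letter (r + 1) (d + k)"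
    using * by metis
  show "r + 1 < i \<Longrightarrow> \<sigma> i = of_nat i \<Longrightarrow>
      (t_elt \<omega> n r [^]\<^bsub>wreath \<omega> n\<^esub> k \<otimes>\<^bsub>wreath \<omega> n\<^esub> \<sigma>) i = of_nat i"
    using * extend_of_nat[of i ?f] assms by simp
qed

lemma mult_extensional: "(\<rho> \<otimes>\<^bsub>wreath \<omega> n\<^esub> \<sigma>) \<in> extensional {1..n}"
  by (simp add: wreath_def)

lemma t_pow_mult_closed:
  fixes k :: nat
  assumes "r < n" "\<sigma> \<in> fixing_above n (Suc r)"
  shows "t_elt \<omega> n r [^]\<^bsub>wreath \<omega> n\<^esub> k \<otimes>\<^bsub>wreath \<omega> n\<^esub> \<sigma> \<in> fixing_above n (Suc r)"
proof -
  obtain c where c: "\<And>i. i \<in> {1..Suc r} \<Longrightarrow> \<sigma> i = letter (Suc r) (c i)"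
    and inj: "inj_on (\<lambda>i. c i mod Suc r) {1..Suc r}"
    using fixing_above_codes[OF assms(2)] by metis
  show ?thesis
  proof (rule codes_fixing_above[OF _ mult_extensional _ _ inj_on_mod_shift[OF inj]])
    show "(t_elt \<omega> n r [^]\<^bsub>wreath \<omega> n\<^esub> k \<otimes>\<^bsub>wreath \<omega> n\<^esub> \<sigma>) i = of_nat i"
      if "i \<in> {Suc r<..n}" for i
      using that assms by (intro t_pow_mult_apply(2)) (auto simp: fixing_above_def)
    show "(t_elt \<omega> n r [^]\<^bsub>wreath \<omega> n\<^esub> k \<otimes>\<^bsub>wreath \<omega> n\<^esub> \<sigma>) i = letter (Suc r) (c i + k)"
      if "i \<in> {1..Suc r}" for i
      using t_pow_mult_apply(1)[of r n i \<sigma> "c i" k] that c[OF that] assms(1) by simp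
  qed simp
qed

lemma t_prod_fixing_above:
  assumes "r \<le> n" shows "t_prod \<omega> n k r \<in> fixing_above n r"
  using assms
proof (induction r)
  case 0
  then show ?case by (auto simp: fixing_above_def wreath_def extensional_def)
next
  case (Suc r)
  then have "t_prod \<omega> n k r \<in> fixing_above n (Suc r)" using fixing_above_Suc[of r n] by simp
  then show ?case using t_pow_mult_closed[of r n] Suc.prems by simp
qed

section \<open>Existence and uniqueness of the flag exponents\<close>

text \<open>
  The product of the lower powers fixes \<open>r + 1\<close>, which has code \<open>0\<close>; the leftmost power shifts
  this to \<open>k r\<close>. This is how \<open>k r\<close> can be read off.
\<close>
lemma t_prod_Suc_last:
  assumes "r < n"
  shows "t_prod \<omega> n k (Suc r) (Suc r) = letter (Suc r) (k r)"
proof -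
  have "t_prod \<omega> n k r (Suc r) = letter (Suc r) 0"
    using t_prod_fixing_above[of r n k] assms by (auto simp: fixing_above_def letter_def)
  then show ?thesis using t_pow_mult_apply(1)[of r n "Suc r" "t_prod \<omega> n k r" 0 "k r"] assms by simp
qed

lemma t_prod_cong:
  "(\<And>i. i < r \<Longrightarrow> k i = k' i) \<Longrightarrow> t_prod \<omega> n k r = t_prod \<omega> n k' r"
  by (induction r) auto

lemma t_pow_mult_cancel:
  fixes k :: nat
  assumes r: "r < n" and \<sigma>: "\<sigma> \<in> fixing_above n (Suc r)" and \<tau>: "\<tau> \<in> fixing_above n (Suc r)"
    and eq: "t_elt \<omega> n r [^]\<^bsub>wreath \<omega> n\<^esub> k \<otimes>\<^bsub>wreath \<omega> n\<^esub> \<sigma> =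
             t_elt \<omega> n r [^]\<^bsub>wreath \<omega> n\<^esub> k \<otimes>\<^bsub>wreath \<omega> n\<^esub> \<tau>"
  shows "\<sigma> = \<tau>"
proof (rule extensionalityI[of _ "{1..n}"])
  obtain c where c: "\<And>i. i \<in> {1..Suc r} \<Longrightarrow> \<sigma> i = letter (Suc r) (c i)"
    using fixing_above_codes[OF \<sigma>] by metis
  obtain d where d: "\<And>i. i \<in> {1..Suc r} \<Longrightarrow> \<tau> i = letter (Suc r) (d i)"
    using fixing_above_codes[OF \<tau>] by metis
  fix i assume i: "i \<in> {1..n}"
  show "\<sigma> i = \<tau> i"
  proof (cases "i \<le> Suc r")
    case True
    then have i': "i \<in> {1..Suc r}" using i by auto
    have "letter (Suc r) (c i + k) = letter (Suc r) (d i + k)"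
      using t_pow_mult_apply(1)[OF r i, of \<sigma> "c i" k] t_pow_mult_apply(1)[OF r i, of \<tau> "d i" k]
        True c[OF i'] d[OF i'] eq by simp
    then have "(c i + k) mod (m * Suc r) = (d i + k) mod (m * Suc r)"
      by (simp add: letter_eq_iff del: mult_Suc_right)
    then have "c i mod (m * Suc r) = d i mod (m * Suc r)" by (simp only: cong_add_rcancel_nat[unfolded cong_def])
    then show ?thesis using c[OF i'] d[OF i'] by (simp add: letter_eq_iff del: mult_Suc_right)
  next
    case False
    then show ?thesis using \<sigma> \<tau> i by (auto simp: fixing_above_def)
  qed
qed (use \<sigma> \<tau> in \<open>auto simp: fixing_above_def\<close>)

lemma t_prod_inj:
  assumes "r \<le> n" "\<And>i. i < r \<Longrightarrow> k i < m * (i + 1)" "\<And>i. i < r \<Longrightarrow> k' i < m * (i + 1)"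
    "t_prod \<omega> n k r = t_prod \<omega> n k' r" "i < r"
  shows "k i = k' i"
  using assms
proof (induction r)
  case (Suc r)
  have "letter (Suc r) (k r) = letter (Suc r) (k' r)"
    using t_prod_Suc_last[of r n] Suc.prems by (metis Suc_le_lessD)
  then have last: "k r = k' r"
    using Suc.prems(2)[of r] Suc.prems(3)[of r] by (simp add: letter_eq_iff del: mult_Suc_right)
  have "t_prod \<omega> n k r \<in> fixing_above n (Suc r)" "t_prod \<omega> n k' r \<in> fixing_above n (Suc r)"
    using t_prod_fixing_above[of r n] fixing_above_Suc[of r n] Suc.prems(1) by auto
  then have "t_prod \<omega> n k r = t_prod \<omega> n k' r"
    using t_pow_mult_cancel[of r n _ _ "k r"] Suc.prems(1,4) last by simp
  then show ?case using Suc last by (cases "i = r") auto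
qed simp

text \<open>
  The exponent of \<open>t\<^sub>r\<close> has to be the code \<open>a\<close> of the last letter. Shifting all codes by
  \<open>m * (r + 1) - a\<close>, which is \<open>-a\<close> modulo the period, makes the last letter \<open>r + 1\<close> and so leads to
  the next smaller subgroup.
\<close>
lemma t_prod_surj:
  assumes "r \<le> n" "\<sigma> \<in> fixing_above n r"
  shows "\<exists>k \<in> (\<Pi>\<^sub>E i\<in>{..<r}. {0..<m * (i + 1)}). \<sigma> = t_prod \<omega> n k r"
  using assms
proof (induction r arbitrary: \<sigma>)
  case 0
  then have "\<sigma> = t_prod \<omega> n (\<lambda>_. undefined) 0"
    by (auto simp: fixing_above_def wreath_def intro!: extensionalityI[of _ "{1..n}"])
  then show ?case by auto
next
  case (Suc r)
  let ?N = "Suc r"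
  let ?M = "m * ?N"
  have M: "0 < ?M" using m by simp
  obtain c where c: "\<And>i. i \<in> {1..?N} \<Longrightarrow> c i < ?M" "\<And>i. i \<in> {1..?N} \<Longrightarrow> \<sigma> i = letter ?N (c i)"
    and inj: "inj_on (\<lambda>i. c i mod ?N) {1..?N}"
    using fixing_above_codes[OF Suc.prems(2)] by metis
  define a where "a = c ?N"
  have a: "a < ?M" using c(1) unfolding a_def by auto
  define \<tau> where
    "\<tau> = (\<lambda>i\<in>{1..n}. if i \<le> ?N then letter ?N (c i + (?M - a)) else of_nat i)"
  have "\<tau> \<in> fixing_above n ?N"
    by (rule codes_fixing_above[OF _ _ _ _ inj_on_mod_shift[OF inj]])
      (use Suc.prems in \<open>auto simp: \<tau>_def\<close>)
  moreover have "\<tau> ?N = of_nat ?N"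
  proof -
    have "\<tau> ?N = letter ?N ?M" using Suc.prems a by (simp add: \<tau>_def a_def del: mult_Suc_right)
    also have "\<dots> = letter ?N 0" by (simp add: letter_eq_iff del: mult_Suc_right)
    finally show ?thesis by (simp add: letter_def)
  qed
  ultimately have "\<tau> \<in> fixing_above n r" using fixing_above_Suc[of r n] Suc.prems by simp
  then obtain k where k: "k \<in> (\<Pi>\<^sub>E i\<in>{..<r}. {0..<m * (i + 1)})" "\<tau> = t_prod \<omega> n k r"
    using Suc by auto
  have "\<sigma> = t_elt \<omega> n r [^]\<^bsub>wreath \<omega> n\<^esub> a \<otimes>\<^bsub>wreath \<omega> n\<^esub> \<tau>"
  proof (rule extensionalityI[OF _ mult_extensional])
    show "\<sigma> \<in> extensional {1..n}" using Suc.prems by (simp add: fixing_above_def)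
    fix i assume i: "i \<in> {1..n}"
    show "\<sigma> i = (t_elt \<omega> n r [^]\<^bsub>wreath \<omega> n\<^esub> a \<otimes>\<^bsub>wreath \<omega> n\<^esub> \<tau>) i"
    proof (cases "i \<le> ?N")
      case True
      have "(t_elt \<omega> n r [^]\<^bsub>wreath \<omega> n\<^esub> a \<otimes>\<^bsub>wreath \<omega> n\<^esub> \<tau>) i = letter ?N (c i + (?M - a) + a)"
        using t_pow_mult_apply(1)[of r n i \<tau> "c i + (?M - a)" a] Suc.prems i True
        by (simp add: \<tau>_def del: mult_Suc_right)
      also have "c i + (?M - a) + a = c i + ?M" using a by linarith
      also have "letter ?N (c i + ?M) = \<sigma> i"
        using c(2)[of i] i True by (simp add: letter_eq_iff del: mult_Suc_right)
      finally show ?thesis by simp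
    next
      case False
      have "\<sigma> i = of_nat i" using Suc.prems i False by (simp add: fixing_above_def)
      moreover have "\<tau> i = of_nat i" using i False by (simp add: \<tau>_def)
      ultimately show ?thesis using t_pow_mult_apply(2)[of r n i \<tau> a] Suc.prems i False by simp
    qed
  qed
  also have "\<dots> = t_prod \<omega> n (k(r := a)) (Suc r)"
    using t_prod_cong[of r k "k(r := a)" n] k(2) by simp
  finally have "\<sigma> = t_prod \<omega> n (k(r := a)) (Suc r)" .
  moreover have "k(r := a) \<in> (\<Pi>\<^sub>E i\<in>{..<Suc r}. {0..<m * (i + 1)})"
    using k(1) a by (auto simp: PiE_iff extensional_def less_Suc_eq)
  ultimately show ?case by blast
qed

lemma flag_exponents:
  assumes "\<pi> \<in> carrier (wreath \<omega> n)"
  shows "flag_exponents m \<omega> n \<pi> \<in> (\<Pi>\<^sub>E i\<in>{..<n}. {0..<m * (i + 1)})"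
    and "t_prod \<omega> n (flag_exponents m \<omega> n \<pi>) n = \<pi>"
proof -
  let ?P = "\<lambda>k. k \<in> (\<Pi>\<^sub>E i\<in>{..<n}. {0..<m * (i + 1)}) \<and> \<pi> = t_prod \<omega> n k n"
  have "\<exists>!k. ?P k"
  proof (rule ex_ex1I)
    show "\<exists>k. ?P k" using t_prod_surj[of n n \<pi>] assms carrier_fixing_above by blast
    fix k k' assume k: "?P k" and k': "?P k'"
    show "k = k'"
    proof (rule PiE_ext)
      show "k i = k' i" if "i \<in> {..<n}" for i
        using that PiE_mem[OF conjunct1[OF k]] PiE_mem[OF conjunct1[OF k']]
        by (intro t_prod_inj[of n n k k', OF _ _ _ trans[OF conjunct2[OF k, symmetric] conjunct2[OF k']]])
          auto
    qed (rule conjunct1[OF k] conjunct1[OF k'])+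
  qed
  then have P: "?P (flag_exponents m \<omega> n \<pi>)" unfolding flag_exponents_def by (rule theI')
  from P show "flag_exponents m \<omega> n \<pi> \<in> (\<Pi>\<^sub>E i\<in>{..<n}. {0..<m * (i + 1)})"
    by (rule conjunct1)
  from P show "t_prod \<omega> n (flag_exponents m \<omega> n \<pi>) n = \<pi>" by (rule conjunct2[THEN sym])
qed

section \<open>The statistic along the chain of subgroups\<close>

text \<open>
  The right-hand side of the theorem for the first \<open>N\<close> positions; the alphabet stays that of \<open>n\<close>.
\<close>
definition colored_major :: "nat \<Rightarrow> nat \<Rightarrow> (nat \<Rightarrow> complex) \<Rightarrow> nat" where
  "colored_major n N \<sigma> = m * major (letter_less m \<omega> n) N \<sigma> +
    (\<Sum>j = 0..m - 1. j * card {i \<in> {1..N}. \<sigma> i / of_real (cmod (\<sigma> i)) = \<omega> ^ j})"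

lemma colored_major_codes:
  assumes N: "1 \<le> N" "N \<le> n"
    and c: "\<And>i. i \<in> {1..N} \<Longrightarrow> c i < m * N"
    and \<sigma>: "\<And>i. i \<in> {1..N} \<Longrightarrow> \<sigma> i = letter N (c i)"
  shows "colored_major n N \<sigma> = code_stat m N c"
proof -
  have "letter_less m \<omega> n (\<sigma> (i + 1)) (\<sigma> i) \<longleftrightarrow> c i < c (i + 1)" if "1 \<le> i" "i < N" for i
    using that \<sigma>[of i] \<sigma>[of "i + 1"] letter_less_iff[OF N c c, of "i + 1" i] by simp
  then have maj: "major (letter_less m \<omega> n) N \<sigma> = (\<Sum>i | 1 \<le> i \<and> i < N \<and> c i < c (i + 1). i)"
    unfolding major_def by (intro sum.cong) auto
  have col: "\<sigma> i / of_real (cmod (\<sigma> i)) = \<omega> ^ j \<longleftrightarrow> c i div N = j" if "i \<in> {1..N}" "j < m" for i j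
  proof -
    have "\<sigma> i / of_real (cmod (\<sigma> i)) = \<omega> ^ (c i div N)"
      unfolding \<sigma>[OF that(1)] letter_def using N by (intro color_div) (simp add: Suc_leI)
    then show ?thesis using power_eq_iff[of "c i div N" j] div_less_m[OF c[OF that(1)]] that(2) by simp
  qed
  have "(\<Sum>j = 0..m - 1. j * card {i \<in> {1..N}. \<sigma> i / of_real (cmod (\<sigma> i)) = \<omega> ^ j})
      = (\<Sum>j = 0..m - 1. \<Sum>i \<in> {i \<in> {1..N}. c i div N = j}. c i div N)"
  proof (rule sum.cong[OF refl])
    fix j assume "j \<in> {0..m - 1}"
    then have "{i \<in> {1..N}. \<sigma> i / of_real (cmod (\<sigma> i)) = \<omega> ^ j} = {i \<in> {1..N}. c i div N = j}"
      using col m by auto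
    then show "j * card {i \<in> {1..N}. \<sigma> i / of_real (cmod (\<sigma> i)) = \<omega> ^ j}
        = (\<Sum>i \<in> {i \<in> {1..N}. c i div N = j}. c i div N)" by simp
  qed
  also have "\<dots> = (\<Sum>i = 1..N. c i div N)"
  proof (rule sum.group)
    show "(\<lambda>i. c i div N) ` {1..N} \<subseteq> {0..m - 1}" using div_less_m[OF c] by fastforce
  qed auto
  finally show ?thesis unfolding colored_major_def code_stat_def maj by simp
qed

lemma colored_major_t_pow_mult:
  assumes r: "r < n" and \<sigma>: "\<sigma> \<in> fixing_above n r" and k: "k < m * Suc r"
  shows "colored_major n (Suc r) (t_elt \<omega> n r [^]\<^bsub>wreath \<omega> n\<^esub> k \<otimes>\<^bsub>wreath \<omega> n\<^esub> \<sigma>)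
       = colored_major n (Suc r) \<sigma> + k"
proof -
  let ?N = "Suc r"
  have \<sigma>': "\<sigma> \<in> fixing_above n ?N" "\<sigma> ?N = of_nat ?N" using fixing_above_Suc[OF r] \<sigma> by auto
  obtain c where c: "\<And>i. i \<in> {1..?N} \<Longrightarrow> c i < m * ?N" "\<And>i. i \<in> {1..?N} \<Longrightarrow> \<sigma> i = letter ?N (c i)"
    and inj: "inj_on (\<lambda>i. c i mod ?N) {1..?N}"
    using fixing_above_codes[OF \<sigma>'(1)] by metis
  have "letter ?N (c ?N) = letter ?N 0" using c(2)[of ?N] \<sigma>'(2) by (simp add: letter_def)
  then have last: "c ?N = 0" using c(1)[of ?N] by (simp add: letter_eq_iff del: mult_Suc_right)
  have "colored_major n ?N (t_elt \<omega> n r [^]\<^bsub>wreath \<omega> n\<^esub> k \<otimes>\<^bsub>wreath \<omega> n\<^esub> \<sigma>)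
      = code_stat m ?N (\<lambda>i. (c i + k) mod (m * ?N))"
  proof (rule colored_major_codes)
    fix i assume i: "i \<in> {1..?N}"
    show "(t_elt \<omega> n r [^]\<^bsub>wreath \<omega> n\<^esub> k \<otimes>\<^bsub>wreath \<omega> n\<^esub> \<sigma>) i = letter ?N ((c i + k) mod (m * ?N))"
      using t_pow_mult_apply(1)[of r n i \<sigma> "c i" k] i r c(2)[OF i] letter_mod[of ?N "c i + k"] by simp
  qed (use r m in auto)
  also have "\<dots> = code_stat m ?N c + k"
    using c(1) inj last k by (intro code_stat_rotate) auto
  also have "code_stat m ?N c = colored_major n ?N \<sigma>"
    using colored_major_codes[of ?N n c \<sigma>] c r by simp
  finally show ?thesis .
qed

text \<open>
  The letter \<open>r + 1\<close> at the new last position is larger than all others and has exponent \<open>0\<close>: it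
  creates neither a descent nor a contribution to the sum of the exponents.
\<close>
lemma colored_major_Suc:
  assumes r: "r < n" and \<sigma>: "\<sigma> \<in> fixing_above n r"
  shows "colored_major n (Suc r) \<sigma> = colored_major n r \<sigma>"
proof -
  let ?N = "Suc r"
  have \<sigma>': "\<sigma> \<in> fixing_above n ?N" "\<sigma> ?N = of_nat ?N" using fixing_above_Suc[OF r] \<sigma> by auto
  obtain c where c: "\<And>i. i \<in> {1..?N} \<Longrightarrow> c i < m * ?N" "\<And>i. i \<in> {1..?N} \<Longrightarrow> \<sigma> i = letter ?N (c i)"
    using fixing_above_codes[OF \<sigma>'(1)] by metis
  have last: "\<sigma> ?N = letter ?N 0" using \<sigma>'(2) by (simp add: letter_def)
  have "\<not> letter_less m \<omega> n (\<sigma> (i + 1)) (\<sigma> i)" if "i = r" "1 \<le> i" for i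
    using last c(1)[of r] c(2)[of r] that r letter_less_iff[of ?N n 0 "c r"] m by simp
  then have "{i. 1 \<le> i \<and> i < ?N \<and> letter_less m \<omega> n (\<sigma> (i + 1)) (\<sigma> i)}
      = {i. 1 \<le> i \<and> i < r \<and> letter_less m \<omega> n (\<sigma> (i + 1)) (\<sigma> i)}"
    by (auto simp: less_Suc_eq)
  then have maj: "major (letter_less m \<omega> n) ?N \<sigma> = major (letter_less m \<omega> n) r \<sigma>"
    by (simp add: major_def)
  have col: "\<sigma> ?N / of_real (cmod (\<sigma> ?N)) = 1" using color_div[of ?N 0] \<sigma>'(2) by simp
  have "j * card {i \<in> {1..?N}. \<sigma> i / of_real (cmod (\<sigma> i)) = \<omega> ^ j}
      = j * card {i \<in> {1..r}. \<sigma> i / of_real (cmod (\<sigma> i)) = \<omega> ^ j}" if "j \<in> {0..m - 1}" for j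
  proof (cases "j = 0")
    case False
    then have "\<omega> ^ j \<noteq> 1" using power_eq_iff[of j 0] that m by simp
    then have "{i \<in> {1..?N}. \<sigma> i / of_real (cmod (\<sigma> i)) = \<omega> ^ j}
      = {i \<in> {1..r}. \<sigma> i / of_real (cmod (\<sigma> i)) = \<omega> ^ j}"
      using col by (auto simp: le_Suc_eq)
    then show ?thesis by simp
  qed simp
  then show ?thesis unfolding colored_major_def maj by (intro arg_cong2[where f = "(+)"] sum.cong refl)
qed

lemma colored_major_t_prod:
  assumes "r \<le> n" "\<And>i. i < r \<Longrightarrow> k i < m * (i + 1)"
  shows "colored_major n r (t_prod \<omega> n k r) = (\<Sum>i<r. k i)"
  using assms
proof (induction r)
  case 0
  then show ?case by (simp add: colored_major_def major_def)
next
  case (Suc r)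
  let ?\<sigma> = "t_prod \<omega> n k r"
  have \<sigma>: "?\<sigma> \<in> fixing_above n r" using t_prod_fixing_above Suc.prems by simp
  have "colored_major n (Suc r) (t_prod \<omega> n k (Suc r)) = colored_major n (Suc r) ?\<sigma> + k r"
    using colored_major_t_pow_mult[OF _ \<sigma>, of "k r"] Suc.prems(1) Suc.prems(2)[of r] by simp
  then show ?case using colored_major_Suc[OF _ \<sigma>] Suc by simp
qed

end

theorem theorem3p1:
  fixes m n :: nat and \<omega> :: complex and \<pi> :: "nat \<Rightarrow> complex"
  assumes "m \<ge> 1" and "n \<ge> 1"
    and "primitive_unity_root m \<omega>"
    and "\<pi> \<in> carrier (wreath \<omega> n)"
  shows "flag_major m \<omega> n \<pi> =
    m * major (letter_less m \<omega> n) n \<pi> +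
    (\<Sum>j = 0..m - 1. j * card {i \<in> {1..n}. \<pi> i / of_real (cmod (\<pi> i)) = \<omega> ^ j})"
proof -
  interpret primitive_root m \<omega> using assms(1,3) by unfold_locales
  let ?k = "flag_exponents m \<omega> n \<pi>"
  have "colored_major n n (t_prod \<omega> n ?k n) = (\<Sum>i<n. ?k i)"
    using flag_exponents(1)[OF assms(4)] by (intro colored_major_t_prod) (auto simp: PiE_iff)
  then show ?thesis
    unfolding flag_exponents(2)[OF assms(4)] colored_major_def flag_major_def by simp
qed

end
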